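(* Let $k>0$ and let $C=\{\sigma\in\mathbb{M} : \sqrt{J_2(\sigma)}\le k\}$ (von Mises yield domain). Let $\sigma\in\mathbb{M}$ satisfy $\sqrt{J_2(\sigma)}=k$. Then, for $\dot\varepsilon,\dot\varepsilon^{e},\dot\varepsilon^{p},\dot\sigma\in\mathbb{M}$, the constitutive laws $$\dot\varepsilon^{e}=\Pi_{T(C,\sigma)}\dot\varepsilon,\qquad \dot\varepsilon^{p}=\Pi_{N(C,\sigma)}\dot\varepsilon,\qquad \dot\sigma=\Pi_{T(C,\sigma)}\mathbb{H}(\dot\varepsilon)$$ are reduced to (i.e. are equivalent to) $$\dot\varepsilon^{p}=\frac{\max(0,\dot\varepsilon:\overline\sigma)}{2k^2}\,\overline\sigma,\qquad \dot\varepsilon^{e}=\dot\varepsilon-\frac{\max(0,\dot\varepsilon:\overline\sigma)}{2k^2}\,\overline\sigma,$$ $$\dot\sigma=\lambda\,\mathrm{tr}(\dot\varepsilon)I+2\mu\dot\varepsilon-\frac{\mu}{k^2}\max(0,\dot\varepsilon:\overline\sigma)\,\overline\sigma.$$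
   Context: $\mathbb{M}$ is the space of real symmetric $3\times3$ matrices with scalar product $\tau:\eta=\mathrm{tr}(\tau\eta)$ and associated (Frobenius) norm $\|\cdot\|$; $I$ is the identity matrix. $\overline\sigma=\sigma-\frac{\mathrm{tr}(\sigma)}{3}I$ is the deviator of $\sigma$ and $J_2(\sigma)=\frac12\|\overline\sigma\|^2$. The elasticity operator is $\mathbb{H}(\tau)=2\mu\tau+\lambda\,\mathrm{tr}(\tau)I$, with constants $\lambda>0$, $\mu>0$. For a nonempty convex set $K\subset\mathbb{M}$ and $\sigma\in K$, the tangent cone is $T(K,\sigma)=\overline{\{\alpha(\eta-\sigma) : \eta\in K,\ \alpha>0\}}$ and the normal cone is $N(K,\sigma)=\{\eta\in\mathbb{M} : \tau:\eta\le 0\ \forall\tau\in T(K,\sigma)\}$. $\Pi_K$ denotes the orthogonal projection onto a nonempty closed convex set $K$. Here $\dot\varepsilon,\dot\varepsilon^e,\dot\varepsilon^p,\dot\sigma$ are the strain rate, elastic strain rate, plastic strain rate and stress rate; the statement concerns them simply as elements of $\mathbb{M}$. *)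

theory Defs
  imports "HOL-Analysis.Analysis"
begin

definition Sym3 :: "(real ^ 3 ^ 3) set" where
  "Sym3 = {A. transpose A = A}"

definition ddot :: "real ^ 3 ^ 3 \<Rightarrow> real ^ 3 ^ 3 \<Rightarrow> real" (infixl "\<bullet>\<bullet>" 70) where
  "\<tau> \<bullet>\<bullet> \<eta> = trace (\<tau> ** \<eta>)"

(* The library's Euclidean structure on real^3^3 restricts on Sym3 to the
   scalar product above, and the library norm is the Frobenius norm.  Hence
   norm, closure and closest_point can be taken from the library; as Sym3 is closed,
   closures in real^3^3 of subsets of Sym3 are closures in Sym3. *)

lemma ddot_eq_inner:
  assumes "\<tau> \<in> Sym3"
  shows "\<tau> \<bullet>\<bullet> \<eta> = inner \<tau> \<eta>"
proof -
  have sym: "\<tau> $ i $ j = \<tau> $ j $ i" for i j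
    using assms by (metis (mono_tags, lifting) Sym3_def mem_Collect_eq transpose_def vec_lambda_beta)
  have "\<tau> \<bullet>\<bullet> \<eta> = (\<Sum>i\<in>UNIV. \<Sum>k\<in>UNIV. \<tau> $ i $ k * \<eta> $ k $ i)"
    by (simp add: ddot_def trace_def matrix_matrix_mult_def)
  also have "\<dots> = (\<Sum>k\<in>UNIV. \<Sum>i\<in>UNIV. \<tau> $ i $ k * \<eta> $ k $ i)"
    by (rule sum.swap)
  also have "\<dots> = inner \<tau> \<eta>"
    by (subst sym) (simp add: inner_vec_def)
  finally show ?thesis .
qed

lemma norm_eq_sqrt_ddot:
  assumes "\<tau> \<in> Sym3"
  shows "norm \<tau> = sqrt (\<tau> \<bullet>\<bullet> \<tau>)"
  using assms by (simp add: ddot_eq_inner norm_eq_sqrt_inner)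

lemma closed_Sym3: "closed Sym3"
proof -
  have eq: "Sym3 = (\<Inter>i. \<Inter>j. {A :: real ^ 3 ^ 3. A $ i $ j = A $ j $ i})"
    by (auto simp: Sym3_def transpose_def vec_eq_iff)
  show ?thesis
    unfolding eq
    by (intro closed_INT ballI closed_Collect_eq continuous_on_component continuous_on_id)
qed

definition deviator :: "real ^ 3 ^ 3 \<Rightarrow> real ^ 3 ^ 3" where
  "deviator \<sigma> = \<sigma> - (trace \<sigma> / 3) *\<^sub>R mat 1"

definition J2 :: "real ^ 3 ^ 3 \<Rightarrow> real" where
  "J2 \<sigma> = (norm (deviator \<sigma>))\<^sup>2 / 2"

definition elasticity :: "real \<Rightarrow> real \<Rightarrow> real ^ 3 ^ 3 \<Rightarrow> real ^ 3 ^ 3" where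
  "elasticity lam \<mu> \<tau> = (2 * \<mu>) *\<^sub>R \<tau> + (lam * trace \<tau>) *\<^sub>R mat 1"

(* Intended for nonempty convex K contained in Sym3 and \<sigma> \<in> K; both cones are then
   nonempty, closed and convex, so closest_point is the orthogonal projection onto them. *)

definition tangent_cone :: "(real ^ 3 ^ 3) set \<Rightarrow> real ^ 3 ^ 3 \<Rightarrow> (real ^ 3 ^ 3) set" where
  "tangent_cone K \<sigma> = closure {\<alpha> *\<^sub>R (\<eta> - \<sigma>) | \<alpha> \<eta>. \<eta> \<in> K \<and> \<alpha> > 0}"

definition normal_cone :: "(real ^ 3 ^ 3) set \<Rightarrow> real ^ 3 ^ 3 \<Rightarrow> (real ^ 3 ^ 3) set" where
  "normal_cone K \<sigma> = {\<eta> \<in> Sym3. \<forall>\<tau> \<in> tangent_cone K \<sigma>. \<tau> \<bullet>\<bullet> \<eta> \<le> 0}"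

definition von_mises_domain :: "real \<Rightarrow> (real ^ 3 ^ 3) set" where
  "von_mises_domain k = {\<sigma> \<in> Sym3. sqrt (J2 \<sigma>) \<le> k}"

end

theory Submission
  imports Defs
begin

text \<open>With \<open>s = deviator \<sigma>\<close>, the tangent cone at a point of the yield surface is the half-space
  \<open>\<tau> : s \<le> 0\<close> of symmetric matrices, because \<open>s\<close> is, up to a factor, the gradient of \<^const>\<open>J2\<close>;
  the normal cone is its polar, the ray spanned by \<open>s\<close>. The projections onto a half-space and onto
  a ray are explicit, and \<open>elasticity lam \<mu> \<epsilon> : s = 2 \<mu> (\<epsilon> : s)\<close> since \<open>s\<close> is traceless.\<close>

text \<open>Variational characterisation of the projection: in the expansion of
  \<open>norm (a - z)\<close> squared about \<open>x\<close>, the cross term has the favourable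
  sign, so \<open>x\<close> is a nearest point, and nearest points of closed convex sets are
  unique.\<close>

lemma closest_point_eqI:
  fixes S :: "'a::euclidean_space set"
  assumes "convex S" "closed S" "x \<in> S" and dot: "\<And>z. z \<in> S \<Longrightarrow> inner (a - x) (z - x) \<le> 0"
  shows "closest_point S a = x"
proof -
  have "dist a x \<le> dist a z" if "z \<in> S" for z
  proof -
    have "(norm (a - z))\<^sup>2 = (norm (a - x))\<^sup>2 + (norm (z - x))\<^sup>2 - 2 * inner (a - x) (z - x)"
      by (simp add: power2_norm_eq_inner inner_simps inner_commute)
    with dot[OF that] have "(norm (a - x))\<^sup>2 \<le> (norm (a - z))\<^sup>2"
      by (smt (verit) zero_le_power2)
    then show ?thesis
      by (simp add: dist_norm)
  qed
  with assms show ?thesis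
    by (metis closest_point_unique)
qed

text \<open>Stated relative to a subspace \<open>V\<close>, since the tangent cone is a half-space
  of \<open>Sym3\<close> only, not of all matrices. As \<open>s\<close> lies in \<open>V\<close>,
  removing the positive part of the \<open>s\<close>-component does not leave
  \<open>V\<close>.\<close>

lemma closest_point_subspace_halfspace:
  fixes s :: "'a::euclidean_space"
  assumes V: "subspace V" and "s \<in> V" "a \<in> V" "s \<noteq> 0"
  shows "closest_point {x \<in> V. inner x s \<le> 0} a = a - (max 0 (inner a s) / inner s s) *\<^sub>R s"
proof -
  let ?H = "{x \<in> V. inner x s \<le> 0}"
  define c where "c = max 0 (inner a s) / inner s s"
  have c: "c * inner s s = max 0 (inner a s)" and "c \<ge> 0"
    using \<open>s \<noteq> 0\<close> by (auto simp: c_def)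
  have "closest_point ?H a = a - c *\<^sub>R s"
  proof (rule closest_point_eqI)
    have H: "?H = V \<inter> {x. inner s x \<le> 0}"
      by (auto simp: inner_commute)
    show "convex ?H" "closed ?H"
      unfolding H using V
      by (auto intro: convex_Int subspace_imp_convex convex_halfspace_le closed_Int closed_subspace closed_halfspace_le)
    show "a - c *\<^sub>R s \<in> ?H"
      using assms c by (auto intro!: subspace_diff subspace_scale simp: inner_diff_left)
    fix z assume z: "z \<in> ?H"
    have "inner (a - (a - c *\<^sub>R s)) (z - (a - c *\<^sub>R s))
        = c * (inner z s - inner a s + c * inner s s)"
      by (simp add: inner_simps inner_commute algebra_simps)
    also have "\<dots> = c * (inner z s - inner a s + max 0 (inner a s))"
      unfolding c ..
    also have "\<dots> \<le> 0"
      \<comment> \<open>If \<open>inner a s <= 0\<close> then \<open>c = 0\<close>; otherwise the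
        bracket collapses to \<open>inner z s\<close>, which is nonpositive on the
        half-space.\<close>
      using z \<open>c \<ge> 0\<close> by (cases "inner a s \<le> 0") (auto simp: c_def mult_nonneg_nonpos divide_nonpos_nonneg)
    finally show "inner (a - (a - c *\<^sub>R s)) (z - (a - c *\<^sub>R s)) \<le> 0" .
  qed
  then show ?thesis
    by (simp add: c_def)
qed

lemma closest_point_ray:
  fixes s :: "'a::euclidean_space"
  assumes "s \<noteq> 0"
  shows "closest_point ((\<lambda>c. c *\<^sub>R s) ` {0..}) a = (max 0 (inner a s) / inner s s) *\<^sub>R s"
    (is "closest_point ?R a = ?c *\<^sub>R s")
proof (rule closest_point_eqI)
  have lin: "linear (\<lambda>c. c *\<^sub>R s)"
    by (simp add: linear_scale_left)
  show "convex ?R"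
    by (intro convex_linear_image lin) simp
  show "closed ?R"
    using assms by (intro closed_injective_linear_image lin) (auto simp: inj_on_def)
  show "?c *\<^sub>R s \<in> ?R"
    by auto
  have c: "?c * inner s s = max 0 (inner a s)"
    using assms by simp
  fix z assume "z \<in> ?R"
  then obtain d where d: "d \<ge> 0" "z = d *\<^sub>R s"
    by auto
  have "inner (a - ?c *\<^sub>R s) (z - ?c *\<^sub>R s) = (d - ?c) * (inner a s - ?c * inner s s)"
    unfolding d by (simp add: inner_simps algebra_simps)
  also have "\<dots> = (d - ?c) * (inner a s - max 0 (inner a s))"
    unfolding c ..
  also have "\<dots> \<le> 0"
    \<comment> \<open>If \<open>inner a s <= 0\<close> the product is \<open>d * inner a s\<close>;
      otherwise the second factor vanishes.\<close>
    using d by (cases "inner a s \<le> 0") (auto simp: mult_nonneg_nonpos)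
  finally show "inner (a - ?c *\<^sub>R s) (z - ?c *\<^sub>R s) \<le> 0" .
qed

lemma subspace_Sym3: "subspace Sym3"
  by (auto simp: subspace_def Sym3_def transpose_def vec_eq_iff)

lemma mat_in_Sym3: "mat c \<in> Sym3"
  by (simp add: Sym3_def)

text \<open>Writing the trace as an inner product lets the rules for \<open>inner\<close> supply its
  linearity.\<close>

lemma inner_mat_1: "inner A (mat 1 :: real ^ 'n ^ 'n) = trace A"
  by (simp add: inner_vec_def mat_def trace_def if_distrib[of "\<lambda>x. _ * x"] cong: if_cong)

lemma trace_deviator: "trace (deviator \<sigma>) = 0"
  unfolding deviator_def inner_mat_1[symmetric] inner_diff_left inner_scaleR_left
  by (simp add: inner_mat_1 trace_I)

lemma deviator_in_Sym3: "\<sigma> \<in> Sym3 \<Longrightarrow> deviator \<sigma> \<in> Sym3"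
  unfolding deviator_def by (intro subspace_diff subspace_scale subspace_Sym3 mat_in_Sym3)

text \<open>\<open>deviator\<close> subtracts a multiple of the identity, which is orthogonal to
  every traceless matrix.\<close>

lemma inner_deviator: "inner (deviator \<tau>) (deviator \<sigma>) = inner \<tau> (deviator \<sigma>)"
proof -
  have "inner (mat 1) (deviator \<sigma>) = 0"
    by (metis inner_commute inner_mat_1 trace_deviator)
  then show ?thesis
    by (simp add: deviator_def[of \<tau>] inner_diff_left)
qed

lemma linear_deviator: "linear deviator"
  unfolding deviator_def inner_mat_1[symmetric]
  by (rule linearI)
    (simp_all add: inner_add_left scaleR_add_left add_divide_distrib scaleR_diff_right)

lemma mem_von_mises_domain_iff:
  assumes "k \<ge> 0"
  shows "\<eta> \<in> von_mises_domain k \<longleftrightarrow> \<eta> \<in> Sym3 \<and> (norm (deviator \<eta>))\<^sup>2 \<le> 2 * k\<^sup>2"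
proof -
  have "sqrt (J2 \<eta>) \<le> k \<longleftrightarrow> J2 \<eta> \<le> k\<^sup>2"
    using assms real_sqrt_le_iff[of "J2 \<eta>" "k\<^sup>2"] by simp
  then show ?thesis
    by (auto simp: von_mises_domain_def J2_def)
qed

lemma norm_deviator_yield_surface:
  assumes "sqrt (J2 \<sigma>) = k"
  shows "(norm (deviator \<sigma>))\<^sup>2 = 2 * k\<^sup>2"
proof -
  have "k\<^sup>2 = J2 \<sigma>"
    unfolding assms[symmetric] by (simp add: J2_def)
  then show ?thesis
    by (simp add: J2_def)
qed

text \<open>A strictly negative product means that \<open>J2\<close> decreases to first order along
  \<tau>, so a short step from \<sigma> stays in the domain and \<tau> is a positive multiple of
  that step.\<close>

lemma interior_direction_in_tangent_cone:
  assumes k: "k > 0" and \<sigma>: "\<sigma> \<in> Sym3" "sqrt (J2 \<sigma>) = k"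
    and \<tau>: "\<tau> \<in> Sym3" "inner \<tau> (deviator \<sigma>) < 0"
  shows "\<tau> \<in> tangent_cone (von_mises_domain k) \<sigma>"
proof -
  define b where "b = inner \<tau> (deviator \<sigma>)"
  define n where "n = (norm (deviator \<tau>))\<^sup>2"
  \<comment> \<open>The squared norm of the deviator changes by \<open>t * (2 * b + t * n)\<close>,
    so \<open>t * n <= - b\<close> suffices. With \<open>n + 1\<close> as denominator,
    \<open>n >= 0\<close> is all that has to be known.\<close>
  define t where "t = - b / (n + 1)"
  have n: "n \<ge> 0" and b: "b < 0"
    using \<tau> by (auto simp: n_def b_def)
  then have t: "t > 0"
    unfolding t_def by (intro divide_pos_pos) auto
  have tn: "t * n \<le> - b"
  proof -
    have "t * (n + 1) = - b"
      using n by (simp add: t_def)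
    with t show ?thesis
      by (simp add: algebra_simps)
  qed
  have "(norm (deviator (\<sigma> + t *\<^sub>R \<tau>)))\<^sup>2 = (norm (deviator \<sigma>))\<^sup>2 + t * (2 * b + t * n)"
    by (simp add: linear_add[OF linear_deviator] linear_scale[OF linear_deviator]
        power2_norm_eq_inner n_def b_def inner_deviator[symmetric, of \<tau> \<sigma>] inner_simps inner_commute
        algebra_simps)
  also have "\<dots> \<le> 2 * k\<^sup>2"
    using t tn b by (simp add: norm_deviator_yield_surface[OF \<sigma>(2)] mult_le_0_iff)
  finally have "\<sigma> + t *\<^sub>R \<tau> \<in> von_mises_domain k"
    using k \<sigma> \<tau> by (simp add: mem_von_mises_domain_iff subspace_Sym3 subspace_add subspace_scale)
  moreover have "\<tau> = (1 / t) *\<^sub>R ((\<sigma> + t *\<^sub>R \<tau>) - \<sigma>)"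
    using t by simp
  ultimately show ?thesis
    unfolding tangent_cone_def using t
    by (intro subsetD[OF closure_subset] CollectI exI[of _ "1 / t"] exI[of _ "\<sigma> + t *\<^sub>R \<tau>"]) simp
qed

text \<open>The half-space is closed and contains all generating directions, hence their closure;
  conversely, each of its elements is a limit of strictly inward directions.\<close>

lemma tangent_cone_von_mises:
  assumes k: "k > 0" and \<sigma>: "\<sigma> \<in> Sym3" "sqrt (J2 \<sigma>) = k"
  shows "tangent_cone (von_mises_domain k) \<sigma> = {\<tau> \<in> Sym3. inner \<tau> (deviator \<sigma>) \<le> 0}"
    (is "?T = ?H")
proof
  let ?s = "deviator \<sigma>"
  have ss: "inner ?s ?s = 2 * k\<^sup>2"
    using norm_deviator_yield_surface[OF \<sigma>(2)] by (simp add: power2_norm_eq_inner)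
  have "closed ?H"
  proof -
    have "?H = Sym3 \<inter> {x. inner ?s x \<le> 0}"
      by (auto simp: inner_commute)
    then show ?thesis
      by (simp add: closed_Int closed_Sym3 closed_halfspace_le)
  qed
  moreover have "\<alpha> *\<^sub>R (\<eta> - \<sigma>) \<in> ?H" if \<eta>: "\<eta> \<in> von_mises_domain k" and \<alpha>: "\<alpha> > 0" for \<alpha> \<eta>
  proof -
    have \<eta>': "\<eta> \<in> Sym3" "(norm (deviator \<eta>))\<^sup>2 \<le> (norm ?s)\<^sup>2"
      using \<eta> k \<sigma> by (auto simp: mem_von_mises_domain_iff norm_deviator_yield_surface)
    \<comment> \<open>Cauchy-Schwarz bounds \<open>inner (deviator \<eta>) ?s\<close> by this
      product: \<sigma> maximises the product with its own deviator over the domain.\<close>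
    then have "norm (deviator \<eta>) * norm ?s \<le> norm ?s * norm ?s"
      by (intro mult_right_mono) auto
    then have "inner (deviator \<eta>) ?s \<le> inner ?s ?s"
      using norm_cauchy_schwarz[of "deviator \<eta>" ?s] by (simp flip: power2_norm_eq_inner power2_eq_square)
    then have "inner (\<eta> - \<sigma>) ?s \<le> 0"
      by (simp add: inner_deviator inner_diff_left)
    with \<alpha> \<eta>' \<sigma> show ?thesis
      by (simp add: subspace_Sym3 subspace_diff subspace_scale mult_le_0_iff)
  qed
  ultimately show "?T \<subseteq> ?H"
    unfolding tangent_cone_def by (intro closure_minimal) blast+
  show "?H \<subseteq> ?T"
  proof
    fix \<tau> assume \<tau>: "\<tau> \<in> ?H"
    \<comment> \<open>Subtracting a small positive multiple of \<open>?s\<close> makes the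
      inequality strict, because \<open>inner ?s ?s > 0\<close>.\<close>
    have mem: "\<tau> - (1 / real (Suc n)) *\<^sub>R ?s \<in> ?T" for n
    proof (rule interior_direction_in_tangent_cone[OF k \<sigma>])
      show "\<tau> - (1 / real (Suc n)) *\<^sub>R ?s \<in> Sym3"
        using \<tau> \<sigma> by (auto intro!: subspace_diff subspace_scale subspace_Sym3 deviator_in_Sym3)
      have "0 < (1 / real (Suc n)) * inner ?s ?s"
        using k by (simp add: ss)
      with \<tau> show "inner (\<tau> - (1 / real (Suc n)) *\<^sub>R ?s) ?s < 0"
        by (simp add: inner_diff_left)
    qed
    have lim: "(\<lambda>n. \<tau> - (1 / real (Suc n)) *\<^sub>R ?s) \<longlonglongrightarrow> \<tau>"
    proof -
      have "(\<lambda>n. \<tau> - (1 / real (Suc n)) *\<^sub>R ?s) \<longlonglongrightarrow> \<tau> - 0 *\<^sub>R ?s"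
        using LIMSEQ_inverse_real_of_nat by (intro tendsto_intros) (simp add: inverse_eq_divide)
      then show ?thesis
        by simp
    qed
    have "closed ?T"
      by (simp add: tangent_cone_def)
    then show "\<tau> \<in> ?T"
      by (rule closed_sequentially[OF _ mem lim])
  qed
qed

text \<open>The polar of a half-space is the ray along its outer normal. Two test directions
  suffice: \<open>- ?s\<close> fixes the sign of the coefficient, and the part of \<eta> orthogonal
  to \<open>?s\<close> must vanish.\<close>

lemma normal_cone_von_mises:
  assumes k: "k > 0" and \<sigma>: "\<sigma> \<in> Sym3" "sqrt (J2 \<sigma>) = k"
  shows "normal_cone (von_mises_domain k) \<sigma> = (\<lambda>c. c *\<^sub>R deviator \<sigma>) ` {0..}"
proof -
  let ?s = "deviator \<sigma>"
  have ss: "inner ?s ?s > 0"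
    using norm_deviator_yield_surface[OF \<sigma>(2)] k by (simp flip: power2_norm_eq_inner)
  have s: "?s \<in> Sym3"
    using \<sigma> by (simp add: deviator_in_Sym3)
  have N: "normal_cone (von_mises_domain k) \<sigma>
      = {\<eta> \<in> Sym3. \<forall>\<tau>\<in>Sym3. inner \<tau> ?s \<le> 0 \<longrightarrow> inner \<tau> \<eta> \<le> 0}"
    unfolding normal_cone_def tangent_cone_von_mises[OF assms] by (auto simp: ddot_eq_inner)
  show ?thesis
    unfolding N
  proof (intro equalityI subsetI)
    fix \<eta> assume \<eta>: "\<eta> \<in> {\<eta> \<in> Sym3. \<forall>\<tau>\<in>Sym3. inner \<tau> ?s \<le> 0 \<longrightarrow> inner \<tau> \<eta> \<le> 0}"
    define c where "c = inner \<eta> ?s / inner ?s ?s"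
    define \<tau> where "\<tau> = \<eta> - c *\<^sub>R ?s"
    have "- ?s \<in> Sym3" "\<tau> \<in> Sym3"
      using \<eta> s by (auto simp: \<tau>_def subspace_Sym3 subspace_neg subspace_diff subspace_scale)
    moreover have \<tau>s: "inner \<tau> ?s = 0"
      using ss by (simp add: \<tau>_def c_def inner_diff_left)
    ultimately have "inner (- ?s) \<eta> \<le> 0" "inner \<tau> \<eta> \<le> 0"
      using \<eta> ss by auto
    \<comment> \<open>Since \<tau> is orthogonal to \<open>?s\<close>,
      \<open>inner \<tau> \<eta>\<close> equals \<open>inner \<tau> \<tau>\<close>.\<close>
    then have c: "c \<ge> 0" and "inner \<tau> \<tau> \<le> 0"
      using ss \<tau>s by (auto simp: c_def inner_commute \<tau>_def inner_diff_right)
    then have "\<tau> = 0"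
      by (metis inner_eq_zero_iff inner_ge_zero order_antisym)
    with c have "c \<ge> 0" "\<eta> = c *\<^sub>R ?s"
      by (auto simp: \<tau>_def)
    then show "\<eta> \<in> (\<lambda>c. c *\<^sub>R ?s) ` {0..}"
      by auto
  next
    fix \<eta> assume "\<eta> \<in> (\<lambda>c. c *\<^sub>R ?s) ` {0..}"
    then show "\<eta> \<in> {\<eta> \<in> Sym3. \<forall>\<tau>\<in>Sym3. inner \<tau> ?s \<le> 0 \<longrightarrow> inner \<tau> \<eta> \<le> 0}"
      using s by (auto simp: subspace_Sym3 subspace_scale mult_nonneg_nonpos)
  qed
qed

lemma elasticity_in_Sym3: "\<epsilon> \<in> Sym3 \<Longrightarrow> elasticity lam \<mu> \<epsilon> \<in> Sym3"
  unfolding elasticity_def by (intro subspace_add subspace_scale subspace_Sym3 mat_in_Sym3)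

text \<open>The deviator is orthogonal to the identity, so the \<open>lam\<close> term does not
  enter the correction of the stress rate.\<close>

lemma inner_elasticity_deviator:
  "inner (elasticity lam \<mu> \<epsilon>) (deviator \<sigma>) = 2 * \<mu> * inner \<epsilon> (deviator \<sigma>)"
  by (simp add: elasticity_def inner_add_left inner_commute[of "mat 1"] inner_mat_1 trace_deviator)

theorem corollary4p1:
  fixes k lam \<mu> :: real
    and C :: "(real ^ 3 ^ 3) set"
    and \<sigma> \<epsilon> \<epsilon>e \<epsilon>p \<sigma>' :: "real ^ 3 ^ 3"
  assumes "lam > 0" and "\<mu> > 0" and "k > 0"
    and "C = von_mises_domain k"
    and "\<sigma> \<in> Sym3" and "sqrt (J2 \<sigma>) = k"
    and "\<epsilon> \<in> Sym3" and "\<epsilon>e \<in> Sym3" and "\<epsilon>p \<in> Sym3" and "\<sigma>' \<in> Sym3"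
  shows "(\<epsilon>e = closest_point (tangent_cone C \<sigma>) \<epsilon> \<and>
          \<epsilon>p = closest_point (normal_cone C \<sigma>) \<epsilon> \<and>
          \<sigma>' = closest_point (tangent_cone C \<sigma>) (elasticity lam \<mu> \<epsilon>))
     \<longleftrightarrow>
         (\<epsilon>p = (max 0 (\<epsilon> \<bullet>\<bullet> deviator \<sigma>) / (2 * k\<^sup>2)) *\<^sub>R deviator \<sigma> \<and>
          \<epsilon>e = \<epsilon> - (max 0 (\<epsilon> \<bullet>\<bullet> deviator \<sigma>) / (2 * k\<^sup>2)) *\<^sub>R deviator \<sigma> \<and>
          \<sigma>' = (lam * trace \<epsilon>) *\<^sub>R mat 1 + (2 * \<mu>) *\<^sub>R \<epsilon>
                - (\<mu> / k\<^sup>2 * max 0 (\<epsilon> \<bullet>\<bullet> deviator \<sigma>)) *\<^sub>R deviator \<sigma>)"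
proof -
  let ?s = "deviator \<sigma>"
  let ?T = "tangent_cone C \<sigma>" and ?N = "normal_cone C \<sigma>"
  have ss: "inner ?s ?s = 2 * k\<^sup>2"
    using norm_deviator_yield_surface \<open>sqrt (J2 \<sigma>) = k\<close> by (simp add: power2_norm_eq_inner)
  with \<open>k > 0\<close> have "?s \<noteq> 0"
    by auto
  note T = tangent_cone_von_mises[OF \<open>k > 0\<close> \<open>\<sigma> \<in> Sym3\<close> \<open>sqrt (J2 \<sigma>) = k\<close>, folded \<open>C = von_mises_domain k\<close>]
  note N = normal_cone_von_mises[OF \<open>k > 0\<close> \<open>\<sigma> \<in> Sym3\<close> \<open>sqrt (J2 \<sigma>) = k\<close>, folded \<open>C = von_mises_domain k\<close>]
  have proj_T: "closest_point ?T a = a - (max 0 (inner a ?s) / (2 * k\<^sup>2)) *\<^sub>R ?s" if "a \<in> Sym3" for a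
    unfolding T ss[symmetric]
    using that \<open>\<sigma> \<in> Sym3\<close> \<open>?s \<noteq> 0\<close>
    by (intro closest_point_subspace_halfspace subspace_Sym3 deviator_in_Sym3)
  have proj_N: "closest_point ?N \<epsilon> = (max 0 (inner \<epsilon> ?s) / (2 * k\<^sup>2)) *\<^sub>R ?s"
    unfolding N ss[symmetric] using \<open>?s \<noteq> 0\<close> by (rule closest_point_ray)
  \<comment> \<open>Positivity of \<mu> lets the factor leave the maximum; dividing by
    \<open>2 * k^2\<close> then gives the coefficient \<mu> / k^2.\<close>
  have "max 0 (2 * \<mu> * inner \<epsilon> ?s) = 2 * \<mu> * max 0 (inner \<epsilon> ?s)"
    using \<open>\<mu> > 0\<close> by (simp add: max_mult_distrib_left)
  then have "closest_point ?T (elasticity lam \<mu> \<epsilon>)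
      = (lam * trace \<epsilon>) *\<^sub>R mat 1 + (2 * \<mu>) *\<^sub>R \<epsilon> - (\<mu> / k\<^sup>2 * max 0 (inner \<epsilon> ?s)) *\<^sub>R ?s"
    using \<open>\<epsilon> \<in> Sym3\<close>
    by (simp add: proj_T elasticity_in_Sym3 inner_elasticity_deviator)
      (simp add: elasticity_def)
  \<comment> \<open>All three projections are now explicit matrices, so both sides of the
    equivalence consist of the same equations.\<close>
  with proj_T[OF \<open>\<epsilon> \<in> Sym3\<close>] proj_N show ?thesis
    unfolding ddot_eq_inner[OF \<open>\<epsilon> \<in> Sym3\<close>] by auto
qed

end
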